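(* Let $\mathcal{A}$ be a countable set of irrational numbers. Then there is a lacunary sequence $(a_n)_{n\ge1}$ of integers such that, for all $\alpha\in\mathcal{A}$, the sequence $(\{a_n\alpha\})_{n\ge1}$ is uniformly distributed modulo 1 and has a dense collection of BRS.
   Context: $\mathbb{N}=\{1,2,\dots\}$; $\{x\}$ denotes the fractional part of $x$. A sequence $(a_n)_{n\ge1}$ of positive integers is lacunary if there is $\lambda>1$ with $a_{n+1}/a_n\ge\lambda$ for all $n\geq 1$. A sequence $(x_n)_{n\ge1}$ in $[0,1)$ is uniformly distributed modulo 1 if $\lim_{N\to\infty}\frac1N\#\{1\le n\le N:x_n\in[a,b)\}=b-a$ for every interval $[a,b)\subseteq[0,1)$. Bounded remainder set (BRS): for a sequence $(x_n)_{n\ge 1}$ in $[0,1)$ and $[a,b)\subseteq[0,1)$ put $D_N([a,b)) = \frac1N\left(\#\{1\le n\le N: x_n\in[a,b)\} - N(b-a)\right)$. The interval $[a,b)$ is a BRS for $(x_n)_{n\geq 1}$ if there is a constant $c$ (independent of $N$) such that $|D_N([a,b))|\le c\,\frac1N$ for all $N\in\mathbb{N}$. The sequence $(x_n)_{n\ge1}$ has a dense collection of BRS if for all $\varepsilon>0$ and all $x,y\in[0,1)$ with $x<y$ there is a BRS $[a,b)$ for the sequence with $|a-x|<\varepsilon$ and $|b-y|<\varepsilon$. *)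

theory Defs
  imports Complex_Main "HOL-Library.Countable_Set"
begin

text \<open>
  Sequences are indexed by the positive integers: they are functions on \<^typ>\<open>nat\<close>
  whose value at 0 is never used. A half-open interval \<open>[a, b)\<close> contained in \<open>[0, 1)\<close>
  is given by its endpoints with \<open>0 \<le> a < b \<le> 1\<close>; in particular \<open>b = 1\<close> is allowed.
\<close>

definition lacunary :: "(nat \<Rightarrow> int) \<Rightarrow> bool" where
  "lacunary a \<longleftrightarrow>
     (\<forall>n\<ge>1. a n > 0) \<and>
     (\<exists>l::real. l > 1 \<and> (\<forall>n\<ge>1. real_of_int (a (n + 1)) / real_of_int (a n) \<ge> l))"

definition visits :: "(nat \<Rightarrow> real) \<Rightarrow> nat \<Rightarrow> real \<Rightarrow> real \<Rightarrow> nat" where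
  "visits x N a b = card {n. 1 \<le> n \<and> n \<le> N \<and> x n \<in> {a..<b}}"

definition unif_dist_mod1 :: "(nat \<Rightarrow> real) \<Rightarrow> bool" where
  "unif_dist_mod1 x \<longleftrightarrow>
     (\<forall>a b. 0 \<le> a \<and> a < b \<and> b \<le> 1 \<longrightarrow>
        (\<lambda>N. real (visits x N a b) / real N) \<longlonglongrightarrow> b - a)"

definition discr :: "(nat \<Rightarrow> real) \<Rightarrow> nat \<Rightarrow> real \<Rightarrow> real \<Rightarrow> real" where
  "discr x N a b = 1 / real N * (real (visits x N a b) - real N * (b - a))"

definition bounded_remainder_set :: "(nat \<Rightarrow> real) \<Rightarrow> real \<Rightarrow> real \<Rightarrow> bool" where
  "bounded_remainder_set x a b \<longleftrightarrow>
     0 \<le> a \<and> a < b \<and> b \<le> 1 \<and>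
     (\<exists>c::real. \<forall>N\<ge>1. \<bar>discr x N a b\<bar> \<le> c * (1 / real N))"

definition dense_BRS :: "(nat \<Rightarrow> real) \<Rightarrow> bool" where
  "dense_BRS x \<longleftrightarrow>
     (\<forall>\<epsilon>>0. \<forall>u\<in>{0..<1}. \<forall>v\<in>{0..<1}. u < v \<longrightarrow>
        (\<exists>a b. bounded_remainder_set x a b \<and> \<bar>a - u\<bar> < \<epsilon> \<and> \<bar>b - v\<bar> < \<epsilon>))"

end

theory Submission
  imports Defs "HOL-Analysis.Kronecker_Approximation_Theorem"
begin

text \<open>
  Were lacunarity not required, \<open>a\<^sub>n = n\<close> would do: for irrational \<open>\<alpha>\<close> the intervals with
  endpoints \<open>{m\<alpha>}\<close> and \<open>{l\<alpha>}\<close> are bounded remainder sets for \<open>({n\<alpha>})\<close> (\<open>Hecke_bounded_remainder_set\<close>), because the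
  centred indicator of such an interval telescopes along the rotation by \<open>\<alpha>\<close>; and by Kronecker's
  theorem the points \<open>{m\<alpha>}\<close> are dense.

  The sequence is therefore taken of the form \<open>a\<^sub>n = n + q\<^sub>n\<close>, where \<open>q\<^sub>n\<close> grows as fast as
  lacunarity demands, but \<open>q\<^sub>n \<alpha>\<close> is extremely close to an integer for all \<open>\<alpha>\<close> in a finite set
  \<open>F\<^sub>n\<close>; the sets \<open>F\<^sub>n\<close> increase to \<open>A\<close>. Such \<open>q\<^sub>n\<close> exist by Dirichlet's simultaneous approximation
  theorem, irrespective of any rational dependence among the \<open>\<alpha>\<close> (\<open>ex_large_shadow\<close>). Closeness is measured
  against the distances of \<open>\<alpha>, 2\<alpha>, \<dots>, n\<alpha>\<close> from the integers. As \<open>n\<alpha> - m\<alpha>\<close> is one of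
  these numbers once \<open>n > m\<close>, the perturbation then does not carry the \<open>n\<close>-th point across
  \<open>{m\<alpha>}\<close>: for all but finitely many \<open>n\<close>, the point \<open>{a\<^sub>n \<alpha>}\<close> lies in a given Hecke interval
  exactly if \<open>{n\<alpha>}\<close> does. So \<open>({a\<^sub>n \<alpha>})\<close> inherits all these bounded remainder sets
  (\<open>shadowing_bounded_remainder_set\<close>).

  Uniform distribution is then automatic (\<open>dense_BRS_imp_unif_dist_mod1\<close>): points visit a
  bounded remainder set with the right frequency, and these sets approximate every interval.
\<close>

section \<open>Counting visits\<close>

lemma real_visits_eq_sum:
  "real (visits x N a b) = (\<Sum>n=1..N. indicator {a..<b} (x n))"
proof -
  have "{n. 1 \<le> n \<and> n \<le> N \<and> x n \<in> {a..<b}} = {1..N} \<inter> {n. x n \<in> {a..<b}}"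
    by auto
  then show ?thesis
    by (simp add: visits_def indicator_def sum.If_cases Int_def)
qed

lemma visits_mono:
  assumes "a \<le> a'" "b' \<le> b"
  shows "visits x N a' b' \<le> visits x N a b"
  unfolding visits_def using assms by (intro card_mono) auto

lemma visits_split:
  assumes "a \<le> b" "b \<le> c"
  shows "real (visits x N a c) = real (visits x N a b) + real (visits x N b c)"
  unfolding real_visits_eq_sum sum.distrib[symmetric]
  using assms by (intro sum.cong) (auto simp: indicator_def)

lemma visits_unit_interval:
  assumes "\<And>n. x n \<in> {0..<1}"
  shows "visits x N 0 1 = N"
proof -
  have "{n. 1 \<le> n \<and> n \<le> N \<and> x n \<in> {0..<1}} = {1..N}"
    using assms by auto
  then show ?thesis by (simp add: visits_def)
qed

lemma bounded_remainder_set_iff: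
  "bounded_remainder_set x a b \<longleftrightarrow> 0 \<le> a \<and> a < b \<and> b \<le> 1 \<and>
     (\<exists>c. \<forall>N\<ge>1. \<bar>real (visits x N a b) - real N * (b - a)\<bar> \<le> c)"
proof -
  have "\<bar>discr x N a b\<bar> \<le> c * (1 / real N) \<longleftrightarrow> \<bar>real (visits x N a b) - real N * (b - a)\<bar> \<le> c"
    if "N \<ge> 1" for N c
  proof -
    have "\<bar>discr x N a b\<bar> = \<bar>real (visits x N a b) - real N * (b - a)\<bar> * (1 / real N)"
      by (simp add: discr_def abs_mult)
    moreover have "1 / real N > 0"
      using that by simp
    ultimately show ?thesis
      by (simp only: mult_le_cancel_right_pos)
  qed
  then show ?thesis
    unfolding bounded_remainder_set_def by blast
qed

text \<open>
  Finitely many exceptional indices only change the constant in the definition of a bounded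
  remainder set.
\<close>

lemma bounded_remainder_set_eventually_cong:
  assumes brs: "bounded_remainder_set y a b"
    and eq: "\<And>n. n \<ge> k \<Longrightarrow> x n \<in> {a..<b} \<longleftrightarrow> y n \<in> {a..<b}"
  shows "bounded_remainder_set x a b"
proof -
  obtain c where c: "\<And>N. N \<ge> 1 \<Longrightarrow> \<bar>real (visits y N a b) - real N * (b - a)\<bar> \<le> c"
    using brs unfolding bounded_remainder_set_iff by blast
  have diff: "\<bar>real (visits x N a b) - real (visits y N a b)\<bar> \<le> real k" for N
  proof -
    have "\<bar>real (visits x N a b) - real (visits y N a b)\<bar>
        = \<bar>\<Sum>n=1..N. indicator {a..<b} (x n) - indicator {a..<b} (y n) :: real\<bar>"
      by (simp add: real_visits_eq_sum sum_subtractf)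
    also have "\<dots> \<le> (\<Sum>n=1..N. \<bar>indicator {a..<b} (x n) - indicator {a..<b} (y n) :: real\<bar>)"
      by (rule sum_abs)
    also have "\<dots> \<le> (\<Sum>n=1..N. indicator {..<k} n)"
      using eq by (intro sum_mono) (auto simp: indicator_def not_less)
    also have "\<dots> = real (card ({1..N} \<inter> {..<k}))"
      by (simp add: indicator_def sum.If_cases lessThan_def)
    also have "\<dots> \<le> real k"
      using card_mono[of "{..<k}" "{1..N} \<inter> {..<k}"] by simp
    finally show ?thesis .
  qed
  have "\<bar>real (visits x N a b) - real N * (b - a)\<bar> \<le> c + real k" if "N \<ge> 1" for N
    using c[OF that] diff[of N] by linarith
  then show ?thesis
    using brs unfolding bounded_remainder_set_iff by blast
qed

section \<open>Density of bounded remainder sets implies uniform distribution\<close>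

lemma bounded_remainder_set_frequency:
  assumes "bounded_remainder_set x a b"
  shows "(\<lambda>N. real (visits x N a b) / real N) \<longlonglongrightarrow> b - a"
proof -
  obtain c where c: "\<And>N. N \<ge> 1 \<Longrightarrow> \<bar>discr x N a b\<bar> \<le> c * (1 / real N)"
    using assms unfolding bounded_remainder_set_def by blast
  have "(\<lambda>N. c * (1 / real N)) \<longlonglongrightarrow> c * 0"
    by (intro tendsto_mult tendsto_const lim_1_over_n)
  then have "(\<lambda>N. c * (1 / real N)) \<longlonglongrightarrow> 0"
    by (simp only: mult_zero_right)
  moreover have "\<forall>\<^sub>F N in sequentially. norm (discr x N a b) \<le> c * (1 / real N)"
    unfolding real_norm_def eventually_sequentially using c by blast
  ultimately have "(\<lambda>N. discr x N a b) \<longlonglongrightarrow> 0"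
    by (rule Lim_null_comparison[rotated])
  then have "(\<lambda>N. discr x N a b + (b - a)) \<longlonglongrightarrow> 0 + (b - a)"
    by (intro tendsto_add tendsto_const)
  moreover have "\<forall>\<^sub>F N in sequentially. discr x N a b + (b - a) = real (visits x N a b) / real N"
    using eventually_ge_at_top[of 1] by eventually_elim (simp add: discr_def field_simps)
  ultimately show ?thesis
    by (simp add: tendsto_cong)
qed

text \<open>
  Bounded remainder sets that nearly exhaust \<open>[a, b)\<close> from inside bound the visiting frequency
  from below. For an upper bound one cannot argue symmetrically from outside, since there may be
  no room around \<open>[a, b)\<close> within the unit interval; the lower bounds for the complementary
  intervals serve instead. This is why the degenerate case \<open>a = b\<close> is included.
\<close>

lemma dense_BRS_lower_frequency:
  assumes dense: "dense_BRS x" and ab: "0 \<le> a" "a \<le> b" "b \<le> 1" and "\<epsilon> > 0"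
  shows "\<forall>\<^sub>F N in sequentially. real (visits x N a b) / real N > b - a - \<epsilon>"
proof (cases "a = b")
  case True
  then show ?thesis
    using \<open>\<epsilon> > 0\<close> by (simp add: less_le_trans[of "- \<epsilon>" 0])
next
  case False
  define \<delta> where "\<delta> = min \<epsilon> (b - a) / 4"
  have \<delta>: "\<delta> > 0" "4 * \<delta> \<le> \<epsilon>" "4 * \<delta> \<le> b - a"
    using False ab \<open>\<epsilon> > 0\<close> by (auto simp: \<delta>_def)
  have "a + \<delta> \<in> {0..<1}" "b - \<delta> \<in> {0..<1}" "a + \<delta> < b - \<delta>"
    using \<delta> ab by auto
  then obtain a' b' where brs: "bounded_remainder_set x a' b'"
      and a': "\<bar>a' - (a + \<delta>)\<bar> < \<delta>" and b': "\<bar>b' - (b - \<delta>)\<bar> < \<delta>"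
    using dense \<delta>(1) unfolding dense_BRS_def by blast
  have "b' - a' > b - a - \<epsilon>"
    using a' b' \<delta> by linarith
  then have "\<forall>\<^sub>F N in sequentially. real (visits x N a' b') / real N > b - a - \<epsilon>"
    using bounded_remainder_set_frequency[OF brs] by (simp add: order_tendsto_iff)
  then show ?thesis
  proof eventually_elim
    case (elim N)
    have "a \<le> a'" "b' \<le> b"
      using a' b' by linarith+
    then have "real (visits x N a' b') / real N \<le> real (visits x N a b) / real N"
      by (intro divide_right_mono) (auto intro: visits_mono)
    then show ?case
      using elim by linarith
  qed
qed

lemma dense_BRS_imp_unif_dist_mod1:
  assumes dense: "dense_BRS x" and x: "\<And>n. x n \<in> {0..<1}"
  shows "unif_dist_mod1 x"
  unfolding unif_dist_mod1_def
proof (intro allI impI)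
  fix a b :: real
  assume ab: "0 \<le> a \<and> a < b \<and> b \<le> 1"
  show "(\<lambda>N. real (visits x N a b) / real N) \<longlonglongrightarrow> b - a"
  proof (rule tendstoI)
    fix \<epsilon> :: real
    assume "\<epsilon> > 0"
    then have "\<epsilon> / 2 > 0" by simp
    note lower = dense_BRS_lower_frequency[OF dense _ _ _ this]
    have "\<forall>\<^sub>F N in sequentially. real (visits x N 0 a) / real N > a - 0 - \<epsilon> / 2"
      "\<forall>\<^sub>F N in sequentially. real (visits x N a b) / real N > b - a - \<epsilon> / 2"
      "\<forall>\<^sub>F N in sequentially. real (visits x N b 1) / real N > 1 - b - \<epsilon> / 2"
      using ab lower[of 0 a] lower[of a b] lower[of b 1] by simp_all
    moreover have "\<forall>\<^sub>F N::nat in sequentially. N \<ge> 1"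
      by (rule eventually_ge_at_top)
    ultimately show "\<forall>\<^sub>F N in sequentially. dist (real (visits x N a b) / real N) (b - a) < \<epsilon>"
    proof eventually_elim
      case (elim N)
      have "real N = real (visits x N 0 a) + real (visits x N a b) + real (visits x N b 1)"
        using ab visits_split[of 0 a 1 x N] visits_split[of a b 1 x N]
          visits_unit_interval[of x N, OF x] by simp
      then have "1 = real (visits x N 0 a) / real N + real (visits x N a b) / real N
          + real (visits x N b 1) / real N"
        using elim by (simp add: add_divide_distrib[symmetric])
      then show ?case
        using elim \<open>\<epsilon> > 0\<close> unfolding dist_real_def by linarith
    qed
  qed
qed

section \<open>Hecke's intervals for the rotation by an irrational number\<close>

text \<open>
  The indicator of an arc of the circle is, up to its mean, the difference of two translates of
  the sawtooth function \<^term>\<open>frac\<close>.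
\<close>

lemma indicator_eq_frac_diff:
  assumes "frac s \<le> frac r"
  shows "indicator {frac s..<frac r} (frac t) =
    frac (t - r) - frac (t - s) + (frac r - frac s :: real)"
proof -
  have frac_diff: "frac (t - u) = frac t - frac u + (if frac t < frac u then 1 else 0)" for u
  proof -
    have "t - u - (frac t - frac u + (if frac t < frac u then 1 else 0)) \<in> \<int>"
      by (simp add: frac_def)
    then show ?thesis
      using frac_lt_1[of t] frac_lt_1[of u] frac_ge_0[of t] frac_ge_0[of u]
      unfolding frac_unique_iff by (cases "frac t < frac u"; simp; linarith)
  qed
  show ?thesis
    using assms by (simp add: frac_diff[of r] frac_diff[of s] indicator_def)
qed

text \<open>
  Shifting the index by one changes a partial sum of \<open>g\<close> only by its two boundary terms.
\<close>

lemma abs_sum_shift_diff_le: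
  fixes g :: "int \<Rightarrow> real"
  assumes g: "\<And>i. g i \<in> {0..1}"
  shows "\<bar>(\<Sum>n=1..N. g (int n - int m)) - (\<Sum>n=1..N. g (int n))\<bar> \<le> real m"
proof (induction m)
  case 0
  then show ?case by simp
next
  case (Suc m)
  have "(\<Sum>n=1..N. g (int n - int (Suc m))) - (\<Sum>n=1..N. g (int n - int m))
      = g (- int m) - g (int N - int m)"
    by (induction N) (simp_all add: algebra_simps)
  then have "\<bar>(\<Sum>n=1..N. g (int n - int (Suc m))) - (\<Sum>n=1..N. g (int n - int m))\<bar> \<le> 1"
    using g[of "- int m"] g[of "int N - int m"] by auto
  then show ?case
    using Suc.IH by simp
qed

lemma Hecke_bounded_remainder_set:
  fixes \<alpha> :: real
  assumes less: "frac (real m * \<alpha>) < frac (real l * \<alpha>)"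
  shows "bounded_remainder_set (\<lambda>n. frac (real n * \<alpha>)) (frac (real m * \<alpha>)) (frac (real l * \<alpha>))"
proof -
  define g where "g i = frac (real_of_int i * \<alpha>)" for i
  let ?a = "frac (real m * \<alpha>)" and ?b = "frac (real l * \<alpha>)"
  have g: "g i \<in> {0..1}" for i
    using frac_lt_1[of "real_of_int i * \<alpha>"] by (simp add: g_def less_imp_le)
  have "\<bar>real (visits (\<lambda>n. frac (real n * \<alpha>)) N ?a ?b) - real N * (?b - ?a)\<bar> \<le> real l + real m" for N
  proof -
    have "real (visits (\<lambda>n. frac (real n * \<alpha>)) N ?a ?b)
        = (\<Sum>n=1..N. g (int n - int l) - g (int n - int m) + (?b - ?a))"
      unfolding real_visits_eq_sum
      using less by (subst indicator_eq_frac_diff) (auto simp: g_def left_diff_distrib)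
    also have "\<dots> = (\<Sum>n=1..N. g (int n - int l)) - (\<Sum>n=1..N. g (int n - int m)) + real N * (?b - ?a)"
      by (simp add: sum.distrib sum_subtractf)
    finally show ?thesis
      using abs_sum_shift_diff_le[of g l N, OF g] abs_sum_shift_diff_le[of g m N, OF g] by linarith
  qed
  then show ?thesis
    using less frac_lt_1[of "real l * \<alpha>"] unfolding bounded_remainder_set_iff
    by (auto intro: less_imp_le)
qed

section \<open>Shadowing the rotation\<close>

text \<open>
  The number \<open>a n\<close> shadows \<open>n\<close> if adding \<open>(a n - n) \<alpha>\<close> moves all of \<open>{\<alpha>}, {2\<alpha>}, \<dots>, {n\<alpha>}\<close> by
  the same amount \<open>e\<close> without wrapping around. Since the indicator of a Hecke interval is a
  difference of two such fractional parts at large times, the shift cancels, so that it is the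
  same at \<open>{a\<^sub>n \<alpha>}\<close> and at \<open>{n\<alpha>}\<close>.
\<close>

lemma shadowing_bounded_remainder_set:
  fixes \<alpha> :: real and a :: "nat \<Rightarrow> int"
  assumes less: "frac (real m * \<alpha>) < frac (real l * \<alpha>)"
    and shadow: "\<And>n. n \<ge> k \<Longrightarrow>
      \<exists>e. \<forall>j\<in>{1..n}. frac (real j * \<alpha> + real_of_int (a n - int n) * \<alpha>) = frac (real j * \<alpha>) + e"
  shows "bounded_remainder_set (\<lambda>n. frac (real_of_int (a n) * \<alpha>))
    (frac (real m * \<alpha>)) (frac (real l * \<alpha>))"
proof (rule bounded_remainder_set_eventually_cong[OF Hecke_bounded_remainder_set[OF less]])
  let ?a = "frac (real m * \<alpha>)" and ?b = "frac (real l * \<alpha>)"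
  fix n
  assume "n \<ge> max k (Suc (max m l))"
  then have n: "n \<ge> k" "m < n" "l < n"
    by auto
  obtain e where e: "\<And>j. j \<in> {1..n} \<Longrightarrow>
      frac (real j * \<alpha> + real_of_int (a n - int n) * \<alpha>) = frac (real j * \<alpha>) + e"
    using shadow[OF n(1)] by blast
  have shift: "frac (real_of_int (a n) * \<alpha> - real i * \<alpha>) = frac (real n * \<alpha> - real i * \<alpha>) + e"
    if "i < n" for i
    using e[of "n - i"] that by (simp add: algebra_simps of_nat_diff)
  have "indicator {?a..<?b} (frac (real_of_int (a n) * \<alpha>))
      = (indicator {?a..<?b} (frac (real n * \<alpha>)) :: real)"
    using less by (simp add: indicator_eq_frac_diff shift[OF n(2)] shift[OF n(3)])
  then show "frac (real_of_int (a n) * \<alpha>) \<in> {?a..<?b} \<longleftrightarrow> frac (real n * \<alpha>) \<in> {?a..<?b}"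
    by (simp only: indicator_def of_bool_eq_iff)
qed

lemma shadowing_dense_BRS:
  fixes \<alpha> :: real and a :: "nat \<Rightarrow> int"
  assumes irrational: "\<alpha> \<notin> \<rat>"
    and shadow: "\<And>n. n \<ge> k \<Longrightarrow>
      \<exists>e. \<forall>j\<in>{1..n}. frac (real j * \<alpha> + real_of_int (a n - int n) * \<alpha>) = frac (real j * \<alpha>) + e"
  shows "dense_BRS (\<lambda>n. frac (real_of_int (a n) * \<alpha>))"
  unfolding dense_BRS_def
proof (intro allI ballI impI)
  fix \<epsilon> u v :: real
  assume \<epsilon>: "\<epsilon> > 0" and u: "u \<in> {0..<1}" and v: "v \<in> {0..<1}" and uv: "u < v"
  \<comment> \<open>Below half the length of \<open>[u, v)\<close>, the approximating endpoints stay in the right order.\<close>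
  define \<delta> where "\<delta> = min \<epsilon> ((v - u) / 2)"
  have \<delta>: "\<delta> > 0" "\<delta> \<le> \<epsilon>" "2 * \<delta> \<le> v - u"
    using \<epsilon> uv by (auto simp: \<delta>_def min_def field_simps)
  obtain m where m: "\<bar>frac (real m * \<alpha>) - u\<bar> < \<delta>"
    using Kronecker_approx_1_explicit[OF irrational, of u \<delta>] u \<delta> by auto
  obtain l where l: "\<bar>frac (real l * \<alpha>) - v\<bar> < \<delta>"
    using Kronecker_approx_1_explicit[OF irrational, of v \<delta>] v \<delta> by auto
  have "frac (real m * \<alpha>) < frac (real l * \<alpha>)"
    using m l \<delta> by linarith
  from shadowing_bounded_remainder_set[OF this shadow]
  show "\<exists>c d. bounded_remainder_set (\<lambda>n. frac (real_of_int (a n) * \<alpha>)) c d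
      \<and> \<bar>c - u\<bar> < \<epsilon> \<and> \<bar>d - v\<bar> < \<epsilon>"
    using m l \<delta> by (meson less_le_trans)
qed

section \<open>Large simultaneous near-periods\<close>

text \<open>
  A small positive denominator \<open>q\<close> for the numbers \<open>K \<alpha>\<close>, with \<open>K \<ge> 1\<close>, gives the denominator
  \<open>K q \<ge> K\<close> for the numbers \<open>\<alpha>\<close> themselves with the same errors; so it can be made large.
\<close>

lemma Dirichlet_approx_simult_large:
  fixes F :: "real set" and M :: int
  assumes "finite F" "\<delta> > 0"
  obtains q :: int and p :: "real \<Rightarrow> int"
  where "q \<ge> M" "\<And>\<alpha>. \<alpha> \<in> F \<Longrightarrow> \<bar>of_int q * \<alpha> - of_int (p \<alpha>)\<bar> < \<delta>"
proof -
  obtain h where h: "bij_betw h {0..<card F} F"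
    using ex_bij_betw_nat_finite[OF \<open>finite F\<close>] by blast
  obtain N :: nat where N: "N > 0" "1 / real N < \<delta>"
    using \<open>\<delta> > 0\<close> by (metis gr_zeroI inverse_eq_divide real_arch_inverse)
  define K where "K = max M 1"
  obtain q p where q: "0 < q"
      and p: "\<And>i. i < card F \<Longrightarrow> \<bar>of_int q * (of_int K * h i) - of_int (p i)\<bar> < 1 / real N"
    using Dirichlet_approx_simult[OF N(1), of "card F" "\<lambda>i. of_int K * h i"] by blast
  have "\<exists>z. \<bar>of_int (K * q) * \<alpha> - of_int z\<bar> < \<delta>" if "\<alpha> \<in> F" for \<alpha>
  proof -
    have "\<alpha> \<in> h ` {0..<card F}"
      using that bij_betw_imp_surj_on[OF h] by simp
    then obtain i where "i < card F" "\<alpha> = h i"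
      by auto
    then show ?thesis
      using p[of i] N(2) by (intro exI[of _ "p i"]) (simp add: mult_ac)
  qed
  then obtain p' where "\<And>\<alpha>. \<alpha> \<in> F \<Longrightarrow> \<bar>of_int (K * q) * \<alpha> - of_int (p' \<alpha>)\<bar> < \<delta>"
    by metis
  moreover have "K * q \<ge> M"
    using mult_left_mono[of 1 q K] q unfolding K_def by linarith
  ultimately show thesis
    using that by blast
qed

text \<open>
  By irrationality none of \<open>\<alpha>, 2\<alpha>, \<dots>, n\<alpha>\<close> is an integer, so the fractional parts do not wrap
  around when \<open>q \<alpha>\<close> is closer to an integer than all of them; the common shift \<open>e\<close> is the signed
  distance of \<open>q \<alpha>\<close> from that integer.
\<close>

lemma ex_large_shadow:
  fixes F :: "real set" and M :: int
  assumes "finite F" and irrational: "\<And>\<alpha>. \<alpha> \<in> F \<Longrightarrow> \<alpha> \<notin> \<rat>"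
  shows "\<exists>q\<ge>M. \<forall>\<alpha>\<in>F. \<exists>e. \<forall>j\<in>{1..n}.
    frac (real j * \<alpha> + real_of_int q * \<alpha>) = frac (real j * \<alpha>) + e"
proof -
  \<comment> \<open>The distances from the integers; the element 1 caters for the case of no distances at all.\<close>
  define D where "D = insert 1
    ((\<lambda>(\<alpha>, j). min (frac (real j * \<alpha>)) (1 - frac (real j * \<alpha>))) ` (F \<times> {1..n}))"
  have "finite D"
    using \<open>finite F\<close> by (simp add: D_def)
  have pos: "frac (real j * \<alpha>) > 0" if "\<alpha> \<in> F" "j \<in> {1..n}" for \<alpha> j
  proof -
    have "real j * \<alpha> \<notin> \<int>"
    proof
      assume "real j * \<alpha> \<in> \<int>"
      then have "real j * \<alpha> / real j \<in> \<rat>"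
        using Ints_subset_Rats by (intro Rats_divide) auto
      then show False
        using irrational that by auto
    qed
    then show ?thesis by (simp add: frac_gt_0_iff)
  qed
  have "Min D > 0"
    using \<open>finite D\<close> pos by (subst Min_gr_iff) (auto simp: D_def frac_lt_1)
  then obtain q p where "q \<ge> M" and p: "\<And>\<alpha>. \<alpha> \<in> F \<Longrightarrow> \<bar>of_int q * \<alpha> - of_int (p \<alpha>)\<bar> < Min D"
    using Dirichlet_approx_simult_large[OF \<open>finite F\<close>, of "Min D" M] by blast
  have "frac (real j * \<alpha> + of_int q * \<alpha>) = frac (real j * \<alpha>) + (of_int q * \<alpha> - of_int (p \<alpha>))"
    if "\<alpha> \<in> F" "j \<in> {1..n}" for \<alpha> j
  proof -
    have "min (frac (real j * \<alpha>)) (1 - frac (real j * \<alpha>)) \<in> D"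
      using that by (auto simp: D_def)
    then have "Min D \<le> min (frac (real j * \<alpha>)) (1 - frac (real j * \<alpha>))"
      using \<open>finite D\<close> by (intro Min_le)
    then have "0 \<le> frac (real j * \<alpha>) + (of_int q * \<alpha> - of_int (p \<alpha>))"
        "frac (real j * \<alpha>) + (of_int q * \<alpha> - of_int (p \<alpha>)) < 1"
      using p[OF that(1)] by linarith+
    then show ?thesis
      by (subst frac_unique_iff) (auto simp: frac_def)
  qed
  then show ?thesis
    using \<open>q \<ge> M\<close> by blast
qed

section \<open>The lacunary sequence\<close>

theorem theorem6:
  fixes A :: "real set"
  assumes "countable A"
    and "\<forall>\<alpha>\<in>A. \<alpha> \<notin> \<rat>"
  shows "\<exists>a :: nat \<Rightarrow> int. lacunary a \<and>
    (\<forall>\<alpha>\<in>A. unif_dist_mod1 (\<lambda>n. frac (real_of_int (a n) * \<alpha>)) \<and>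
            dense_BRS (\<lambda>n. frac (real_of_int (a n) * \<alpha>)))"
proof -
  \<comment> \<open>Finite stages exhausting \<open>A\<close>; each \<open>\<alpha>\<close> belongs to all stages from some index on.\<close>
  define F where "F n = {\<alpha>\<in>A. to_nat_on A \<alpha> \<le> n}" for n
  have finite_F: "finite (F n)" for n
  proof (rule finite_imageD)
    show "finite (to_nat_on A ` F n)"
      by (rule finite_subset[of _ "{..n}"]) (auto simp: F_def)
    show "inj_on (to_nat_on A) (F n)"
      by (rule inj_on_subset[OF inj_on_to_nat_on[OF \<open>countable A\<close>]]) (auto simp: F_def)
  qed
  define P where "P n z \<longleftrightarrow> z > 0 \<and> (\<forall>\<alpha>\<in>F n. \<exists>e. \<forall>j\<in>{1..n}.
    frac (real j * \<alpha> + real_of_int (z - int n) * \<alpha>) = frac (real j * \<alpha>) + e)" for n and z :: int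
  have ex_P: "\<exists>z. P n z \<and> z \<ge> M" for n and M :: int
  proof -
    obtain q where q: "q \<ge> max M 1" "\<forall>\<alpha>\<in>F n. \<exists>e. \<forall>j\<in>{1..n}.
        frac (real j * \<alpha> + real_of_int q * \<alpha>) = frac (real j * \<alpha>) + e"
      using ex_large_shadow[OF finite_F, of n "max M 1" n] assms(2) unfolding F_def by blast
    then have "P n (int n + q) \<and> int n + q \<ge> M"
      by (auto simp: P_def)
    then show ?thesis by blast
  qed
  have "\<exists>a. \<forall>n. P n (a n) \<and> a (Suc n) \<ge> 2 * a n"
    using ex_P by (intro dependent_nat_choice) blast+
  then obtain a where P: "\<And>n. P n (a n)" and grow: "\<And>n. a (Suc n) \<ge> 2 * a n"
    by blast
  have pos: "a n > 0" for n
    using P by (simp add: P_def)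
  have "real_of_int (a (n + 1)) / real_of_int (a n) \<ge> 2" for n
  proof -
    have "real_of_int (2 * a n) \<le> real_of_int (a (Suc n))"
      using grow[of n] by (simp only: of_int_le_iff)
    then show ?thesis
      using pos[of n] by (simp add: field_simps)
  qed
  then have "lacunary a"
    using pos unfolding lacunary_def by (intro conjI exI[of _ 2]) auto
  moreover have "unif_dist_mod1 (\<lambda>n. frac (real_of_int (a n) * \<alpha>)) \<and>
      dense_BRS (\<lambda>n. frac (real_of_int (a n) * \<alpha>))" if "\<alpha> \<in> A" for \<alpha>
  proof -
    have "\<exists>e. \<forall>j\<in>{1..n}. frac (real j * \<alpha> + real_of_int (a n - int n) * \<alpha>) = frac (real j * \<alpha>) + e"
      if "n \<ge> to_nat_on A \<alpha>" for n
      using P[of n] \<open>\<alpha> \<in> A\<close> that unfolding P_def F_def by blast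
    then have "dense_BRS (\<lambda>n. frac (real_of_int (a n) * \<alpha>))"
      using assms(2) \<open>\<alpha> \<in> A\<close> by (intro shadowing_dense_BRS) auto
    then show ?thesis
      by (auto intro!: dense_BRS_imp_unif_dist_mod1 simp: frac_lt_1)
  qed
  ultimately show ?thesis
    by blast
qed

end
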